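(* Let $T$ be a plane tree with $n$ edges whose vertices are labelled $0,1,\dots,n$ in the order in which they are visited by the right-to-left preorder traversal. Let $0\le m\le n$ and let $w$ be the vertex labelled $m$. Then the doubly rooted plane tree $(T,w)$ corresponds, under the bijection $\Phi$ described below, to a free Dyck path having exactly $m$ down steps (equivalently, $m$ up steps) below the $x$-axis.
   Context: A plane tree is a rooted tree with linearly ordered children. The right-to-left preorder traversal of a plane tree visits the root first and then, if the subtrees of the root are $T_1,\dots,T_k$ from left to right, recursively traverses $T_k,T_{k-1},\dots,T_1$ in this order. A free Dyck path of length $2n$ is a lattice path from $(0,0)$ to $(2n,0)$ with $n$ up steps $U=(1,1)$ and $n$ down steps $D=(1,-1)$; a step is below the $x$-axis if it lies in the half-plane $y\le 0$ and is not on the axis (i.e. connects heights $-j$ and $-j+1$ for some $j\ge1$). The glove bijection sends a plane tree to the Dyck path obtained by a left-to-right preorder (depth-first) traversal, writing $U$ when an edge is traversed downward and $D$ when it is traversed back upward. Butterfly decomposition: for a plane tree $T$ with distinguished vertex $w$, let $v_1v_2\cdots v_kw$ be the path from the root $v_1$ to $w$ (with $k=0$ if $w$ is the root), set $v_{k+1}=w$; let $L_i$ be the subtree consisting of $v_i$ and all descendants of $v_i$ through children of $v_i$ to the left of $v_{i+1}$, $R_i$ the analogous subtree for children to the right of $v_{i+1}$, and $T'$ the subtree rooted at $w$. The bijection $\Phi$: let $P_i$ ($1\le i\le k$) be the glove image of $L_i$ and $P_{k+1}$ that of $T'$; let $Q_i$ be obtained by adding a new root above the root of $R_i$ (joined by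 one edge), taking the glove image, and reflecting it in the $x$-axis. Then $\Phi(T,w)=P_1Q_1P_2Q_2\cdots P_kQ_kP_{k+1}$. *)

theory Defs
  imports Main
begin

datatype plane_tree = Node (children: "plane_tree list")

fun num_edges :: "plane_tree \<Rightarrow> nat" where
  "num_edges (Node ts) = (\<Sum>t\<leftarrow>ts. Suc (num_edges t))"

text \<open>A vertex is addressed by the list of child positions (counted from the left, starting
  at 0) along the path from the root; the root itself is the empty address.\<close>

fun is_vertex :: "plane_tree \<Rightarrow> nat list \<Rightarrow> bool" where
  "is_vertex T [] \<longleftrightarrow> True"
| "is_vertex (Node ts) (i # p) \<longleftrightarrow> i < length ts \<and> is_vertex (ts ! i) p"

fun subtree_at :: "plane_tree \<Rightarrow> nat list \<Rightarrow> plane_tree" where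
  "subtree_at T [] = T"
| "subtree_at T (i # p) = subtree_at (children T ! i) p"

text \<open>The addresses of all vertices, listed in right-to-left preorder. The vertex labelled
  \<open>m\<close> is the entry at position \<open>m\<close>.\<close>

function rl_preorder :: "plane_tree \<Rightarrow> nat list list" where
  "rl_preorder (Node ts) =
     [] # concat (map (\<lambda>i. map ((#) i) (rl_preorder (ts ! i))) (rev [0..<length ts]))"
  by pat_completeness auto
termination
  by (relation "measure size") (auto simp: less_Suc_eq_le intro!: size_list_estimation' nth_mem)

lemma length_rl_preorder: "length (rl_preorder T) = Suc (num_edges T)"
proof (induction T rule: rl_preorder.induct)
  case (1 ts)
  have "(\<Sum>i\<leftarrow>rev [0..<length ts]. length (rl_preorder (ts ! i)))
      = (\<Sum>i\<leftarrow>rev [0..<length ts]. Suc (num_edges (ts ! i)))"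
    using 1 by (intro arg_cong[where f = sum_list] map_cong) auto
  also have "\<dots> = (\<Sum>i\<leftarrow>[0..<length ts]. Suc (num_edges (ts ! i)))"
    by (simp only: rev_map[symmetric] sum_list_rev)
  also have "map (\<lambda>i. Suc (num_edges (ts ! i))) [0..<length ts]
      = map (\<lambda>t. Suc (num_edges t)) ts"
    by (rule nth_equalityI) auto
  finally show ?case
    by (simp add: length_concat comp_def)
qed

lemma set_rl_preorder: "set (rl_preorder T) = {w. is_vertex T w}"
proof (induction T rule: rl_preorder.induct)
  case (1 ts)
  have "w \<in> set (rl_preorder (Node ts)) \<longleftrightarrow> is_vertex (Node ts) w" for w
    using 1 by (cases w) auto
  then show ?case by blast
qed

lemma distinct_rl_preorder: "distinct (rl_preorder T)"
proof (induction T rule: rl_preorder.induct)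
  case (1 ts)
  have "distinct (concat (map (\<lambda>i. map ((#) i) (rl_preorder (ts ! i))) is))"
    if "distinct is" "set is \<subseteq> {..<length ts}" for "is"
    using that 1 by (induction "is") (auto simp: distinct_map)
  from this[of "rev [0..<length ts]"] show ?case by (auto simp: subset_iff)
qed

datatype step = U | D

fun step_height :: "step \<Rightarrow> int" where
  "step_height U = 1"
| "step_height D = - 1"

definition height :: "step list \<Rightarrow> nat \<Rightarrow> int" where
  "height P i = (\<Sum>s\<leftarrow>take i P. step_height s)"

definition free_dyck_path :: "nat \<Rightarrow> step list \<Rightarrow> bool" where
  "free_dyck_path n P \<longleftrightarrow> length P = 2 * n \<and> count_list P U = n \<and> count_list P D = n"

definition step_below :: "step list \<Rightarrow> nat \<Rightarrow> bool" where
  "step_below P i \<longleftrightarrow> (\<exists>j\<ge>1. {height P i, height P (Suc i)} = {- j, - j + 1})"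

lemma step_below_iff_halfplane:
  assumes "i < length P"
  shows "step_below P i \<longleftrightarrow> height P i \<le> 0 \<and> height P (Suc i) \<le> 0"
proof -
  have h: "height P (Suc i) = height P i + step_height (P ! i)"
    using assms by (simp add: height_def take_Suc_conv_app_nth)
  show ?thesis
  proof (cases "P ! i")
    case U
    with h show ?thesis
      unfolding step_below_def
      by (auto simp: doubleton_eq_iff intro!: exI[of _ "- height P i"])
  next
    case D
    with h show ?thesis
      unfolding step_below_def
      by (auto simp: doubleton_eq_iff intro!: exI[of _ "- height P (Suc i)"])
  qed
qed

definition steps_below :: "step \<Rightarrow> step list \<Rightarrow> nat" where
  "steps_below s P = card {i. i < length P \<and> P ! i = s \<and> step_below P i}"

fun reflect_step :: "step \<Rightarrow> step" where
  "reflect_step U = D"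
| "reflect_step D = U"

definition reflect :: "step list \<Rightarrow> step list" where
  "reflect P = map reflect_step P"

fun glove :: "plane_tree \<Rightarrow> step list" where
  "glove (Node ts) = concat (map (\<lambda>t. U # glove t @ [D]) ts)"

text \<open>Butterfly decomposition. For \<open>i < length w\<close>, the vertex \<open>take i w\<close> is the
  \<open>i\<close>-th one, counting from 0, on the path from the root to \<open>w\<close>, and its child at position
  \<open>w ! i\<close> is the next one.\<close>

definition left_wing :: "plane_tree \<Rightarrow> nat list \<Rightarrow> nat \<Rightarrow> plane_tree" where
  "left_wing T w i = Node (take (w ! i) (children (subtree_at T (take i w))))"

definition right_wing :: "plane_tree \<Rightarrow> nat list \<Rightarrow> nat \<Rightarrow> plane_tree" where
  "right_wing T w i = Node (drop (Suc (w ! i)) (children (subtree_at T (take i w))))"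

definition butterfly_path :: "plane_tree \<Rightarrow> nat list \<Rightarrow> step list" (\<open>\<Phi>\<close>) where
  "\<Phi> T w =
     concat (map (\<lambda>i. glove (left_wing T w i) @ reflect (glove (Node [right_wing T w i])))
       [0..<length w])
     @ glove (subtree_at T w)"

end

theory Submission
  imports Defs
begin

text \<open>Every factor \<open>P\<^sub>i\<close>, \<open>Q\<^sub>i\<close> of the path \<open>\<Phi> T w\<close> starts and ends on the axis; the \<open>P\<^sub>i\<close> stay
  weakly above it and the \<open>Q\<^sub>i\<close> weakly below it. So the up steps (or the down steps) below
  the axis number as many as the edges of the right wings, each extended by its new root edge.
  On the other hand, right-to-left preorder visits before \<open>w\<close> precisely the proper ancestors of
  \<open>w\<close> and the non-root vertices of the right wings. Both counts obey the same recursion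
  along the path from the root to \<open>w\<close>.\<close>

text \<open>Both terms make sense for every \<open>i\<close>: past its end \<open>P\<close> keeps
  its final height, and truncated subtraction gives \<open>height Q 0 = 0\<close> before
  that.\<close>

lemma height_append: "height (P @ Q) i = height P i + height Q (i - length P)"
  by (simp add: height_def)

lemma height_reflect: "height (reflect P) i = - height P i"
proof -
  have "step_height (reflect_step s) = - step_height s" for s
    by (cases s) auto
  then show ?thesis
    by (simp add: height_def reflect_def take_map comp_def uminus_sum_list_map)
qed

lemma length_reflect [simp]: "length (reflect P) = length P"
  by (simp add: reflect_def)

lemma count_list_reflect: "count_list (reflect P) s = count_list P (reflect_step s)"
proof -
  have "reflect_step x = s \<longleftrightarrow> x = reflect_step s" for x
    by (cases x; cases s) auto
  then show ?thesis
    unfolding reflect_def by (induction P) auto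
qed

lemma count_list_glove: "count_list (glove T) s = num_edges T"
proof (induction T)
  case (Node ts)
  then show ?case
    by (induction ts) (cases s; auto)+
qed

lemma length_eq_count_list: "length P = count_list P U + count_list P D"
proof (induction P)
  case (Cons s P)
  then show ?case by (cases s) auto
qed simp

lemma height_length: "height P (length P) = int (count_list P U) - int (count_list P D)"
proof (induction P)
  case (Cons s P)
  then show ?case by (cases s) (auto simp: height_def)
qed (simp add: height_def)

lemma height_length_glove [simp]: "height (glove T) (length (glove T)) = 0"
  by (simp add: height_length count_list_glove)

text \<open>Each child contributes its own path raised by one between \<open>U\<close> and
  \<open>D\<close>, so the closing \<open>D\<close> only comes back to the axis.\<close>

lemma height_glove_nonneg: "0 \<le> height (glove T) i"
proof (induction T arbitrary: i)
  case (Node ts)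
  have excursion: "0 \<le> height (U # glove t @ [D]) i" if "t \<in> set ts" for t i
  proof (cases i)
    case (Suc j)
    have "height (U # glove t @ [D]) i = 1 + height (glove t) j + height [D] (j - length (glove t))"
      using Suc height_append[of "glove t" "[D]" j] by (simp add: height_def)
    moreover have "- 1 \<le> height [D] k" for k
      by (cases k) (auto simp: height_def)
    ultimately show ?thesis
      using Node.IH[OF that, of j] by (smt (verit))
  qed (simp add: height_def)
  \<comment> \<open>Stated for any \<open>us\<close> with entries from \<open>ts\<close>, so that
    the list induction leaves \<open>Node.IH\<close> for \<open>ts\<close> untouched.\<close>
  have "0 \<le> height (concat (map (\<lambda>t. U # glove t @ [D]) us)) i" if "set us \<subseteq> set ts" for us
    using that
  proof (induction us arbitrary: i)
    case (Cons t us)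
    then show ?case
      using excursion[of t i]
        height_append[of "U # glove t @ [D]" "concat (map (\<lambda>t. U # glove t @ [D]) us)" i]
      by simp
  qed (simp add: height_def)
  then show ?case by simp
qed

text \<open>Since \<open>P\<close> returns to the axis, the heights along \<open>Q\<close> are not
  shifted, and the indices below the axis split at \<open>length P\<close>.\<close>

lemma steps_below_append:
  assumes "height P (length P) = 0"
  shows "steps_below s (P @ Q) = steps_below s P + steps_below s Q"
proof -
  let ?B = "\<lambda>R. {i. i < length R \<and> R ! i = s \<and> step_below R i}"
  have left: "height (P @ Q) i = height P i" if "i \<le> length P" for i
    using that by (simp add: height_def)
  have right: "height (P @ Q) (length P + i) = height Q i" for i
    using assms by (simp add: height_def)
  have below_left: "step_below (P @ Q) i \<longleftrightarrow> step_below P i" if "i < length P" for i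
    using that by (simp add: step_below_def left)
  have below_right: "step_below (P @ Q) (length P + i) \<longleftrightarrow> step_below Q i" for i
    using right[of i] right[of "Suc i"] by (simp add: step_below_def)
  have "?B (P @ Q) = ?B P \<union> (+) (length P) ` ?B Q"
  proof (rule set_eqI)
    fix i
    show "i \<in> ?B (P @ Q) \<longleftrightarrow> i \<in> ?B P \<union> (+) (length P) ` ?B Q"
    proof (cases "i < length P")
      case True
      then show ?thesis by (auto simp: nth_append below_left)
    next
      case False
      then obtain j where "i = length P + j"
        by (metis le_iff_add not_less)
      then show ?thesis by (auto simp: below_right)
    qed
  qed
  moreover have "?B P \<inter> (+) (length P) ` ?B Q = {}"
    by auto
  ultimately show ?thesis
    by (simp add: steps_below_def card_Un_disjoint card_image)
qed

lemma steps_below_nonneg_path: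
  assumes "\<And>i. 0 \<le> height P i"
  shows "steps_below s P = 0"
proof -
  have "\<not> step_below P i" for i
    using assms[of i] assms[of "Suc i"] by (auto simp: step_below_def doubleton_eq_iff)
  then show ?thesis by (simp add: steps_below_def)
qed

lemma steps_below_nonpos_path:
  assumes "\<And>i. height P i \<le> 0"
  shows "steps_below s P = count_list P s"
proof -
  have "{i. i < length P \<and> P ! i = s \<and> step_below P i} = {i. i < length P \<and> P ! i = s}"
    using assms by (auto simp: step_below_iff_halfplane)
  then show ?thesis
    by (simp add: steps_below_def count_list_eq_length_filter length_filter_conv_card eq_commute)
qed

lemma steps_below_glove: "steps_below s (glove T) = 0"
  by (simp add: steps_below_nonneg_path height_glove_nonneg)

lemma steps_below_reflect_glove: "steps_below s (reflect (glove T)) = num_edges T"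
  by (simp add: steps_below_nonpos_path height_reflect height_glove_nonneg count_list_reflect
      count_list_glove)

lemma butterfly_path_Nil: "\<Phi> T [] = glove T"
  by (simp add: butterfly_path_def)

text \<open>Dropping the root shifts the wing indices by one: the later wings of
  \<open>i # p\<close> are those of \<open>p\<close> in \<open>ts ! i\<close>.\<close>

lemma butterfly_path_Cons:
  "\<Phi> (Node ts) (i # p) =
     glove (Node (take i ts)) @ reflect (glove (Node [Node (drop (Suc i) ts)])) @ \<Phi> (ts ! i) p"
proof -
  have "[0..<length (i # p)] = 0 # map Suc [0..<length p]"
    by (simp add: map_Suc_upt upt_conv_Cons del: upt_Suc)
  then show ?thesis
    unfolding butterfly_path_def
    by (simp add: comp_def left_wing_def right_wing_def del: upt_Suc glove.simps)
qed

lemma num_edges_split: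
  assumes "i < length ts"
  shows "num_edges (Node ts) =
    num_edges (Node (take i ts)) + Suc (num_edges (ts ! i)) + num_edges (Node (drop (Suc i) ts))"
  using arg_cong[OF id_take_nth_drop[OF assms], of "\<lambda>us. num_edges (Node us)"] by simp

text \<open>The root edge added to each right wing makes up for the edge of the path to
  \<open>w\<close> that the decomposition removes.\<close>

lemma count_list_butterfly_path:
  assumes "is_vertex T w"
  shows "count_list (\<Phi> T w) s = num_edges T"
  using assms
proof (induction T w rule: is_vertex.induct)
  case (2 ts i p)
  then show ?case
    by (simp add: butterfly_path_Cons count_list_reflect count_list_glove num_edges_split[of i ts]
        del: glove.simps num_edges.simps) simp
qed (simp add: butterfly_path_Nil count_list_glove)

text \<open>The left wing lies weakly above the axis and contributes nothing; \<open>Suc\<close> is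
  the edge added above the right wing.\<close>

lemma steps_below_butterfly_path_Cons:
  "steps_below s (\<Phi> (Node ts) (i # p)) =
     Suc (num_edges (Node (drop (Suc i) ts))) + steps_below s (\<Phi> (ts ! i) p)"
proof -
  have "num_edges (Node [t]) = Suc (num_edges t)" for t
    by simp
  then show ?thesis
    by (simp add: butterfly_path_Cons steps_below_append height_reflect steps_below_glove
        steps_below_reflect_glove del: glove.simps num_edges.simps)
qed

text \<open>The root and the non-root vertices of the right wing, one per edge, come before the
  block of child \<open>i\<close>; the bound on \<open>k\<close> keeps the index inside that
  block.\<close>

lemma rl_preorder_nth_Cons:
  assumes "i < length ts" and "k \<le> num_edges (ts ! i)"
  shows "rl_preorder (Node ts) ! (Suc (num_edges (Node (drop (Suc i) ts))) + k) =
    i # rl_preorder (ts ! i) ! k"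
proof -
  let ?f = "\<lambda>i. map ((#) i) (rl_preorder (ts ! i))"
  let ?right = "concat (map ?f (rev [Suc i..<length ts]))"
  have "[0..<length ts] = [0..<i] @ i # [Suc i..<length ts]"
    using assms(1) upt_add_eq_append[of 0 i "length ts - i"] by (simp add: upt_conv_Cons)
  then have split: "rl_preorder (Node ts) = [] # ?right @ ?f i @ concat (map ?f (rev [0..<i]))"
    by simp
  have "map (\<lambda>j. Suc (num_edges (ts ! j))) [Suc i..<length ts] =
      map (\<lambda>t. Suc (num_edges t)) (drop (Suc i) ts)"
    by (rule nth_equalityI) auto
  then have "length ?right = num_edges (Node (drop (Suc i) ts))"
    by (simp add: length_concat comp_def length_rl_preorder rev_map[symmetric])
  then show ?thesis
    using assms(2)
    by (simp add: split nth_append length_rl_preorder del: rl_preorder.simps num_edges.simps)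
qed

text \<open>The bound is proved along with the position because \<open>rl_preorder_nth_Cons\<close>
  needs it for the subtree.\<close>

lemma rl_preorder_nth_steps_below:
  assumes "is_vertex T w"
  shows "steps_below s (\<Phi> T w) \<le> num_edges T \<and> rl_preorder T ! steps_below s (\<Phi> T w) = w"
  using assms
proof (induction T w rule: is_vertex.induct)
  case (1 T)
  then show ?case
    by (cases T) (simp add: butterfly_path_Nil steps_below_glove del: glove.simps)
next
  case (2 ts i p)
  then have i: "i < length ts"
    and IH: "steps_below s (\<Phi> (ts ! i) p) \<le> num_edges (ts ! i)"
      "rl_preorder (ts ! i) ! steps_below s (\<Phi> (ts ! i) p) = p"
    by auto
  show ?case
    unfolding steps_below_butterfly_path_Cons rl_preorder_nth_Cons[OF i IH(1)]
    using IH num_edges_split[OF i] by simp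
qed

theorem theorem3p2:
  fixes T :: plane_tree and n m :: nat and w :: "nat list"
  assumes "num_edges T = n" and "m \<le> n" and "w = rl_preorder T ! m"
  shows "free_dyck_path n (\<Phi> T w) \<and> steps_below D (\<Phi> T w) = m \<and> steps_below U (\<Phi> T w) = m"
proof -
  have m: "m < length (rl_preorder T)"
    using assms by (simp add: length_rl_preorder)
  then have "w \<in> set (rl_preorder T)"
    using assms(3) by simp
  then have w: "is_vertex T w"
    by (simp add: set_rl_preorder)
  \<comment> \<open>\<open>w\<close> stands at both positions of a list with distinct entries, so
    the positions agree.\<close>
  have "steps_below s (\<Phi> T w) = m" for s
    using rl_preorder_nth_steps_below[OF w, of s] m assms(3)
      nth_eq_iff_index_eq[OF distinct_rl_preorder[of T], of "steps_below s (\<Phi> T w)" m]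
    by (simp add: length_rl_preorder less_Suc_eq_le)
  moreover have "free_dyck_path n (\<Phi> T w)"
    using assms(1)
    by (simp add: free_dyck_path_def length_eq_count_list count_list_butterfly_path[OF w])
  ultimately show ?thesis by simp
qed

end
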